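(* Let $p$ be a prime number and let $F$ be an extension field of $\mathbb{Z}_p$ of finite vector space dimension $n\ge 1$. Let $\alpha \in F\setminus\{0\}$ be such that $x^{p}-x-\alpha$ is irreducible in $F[x]$, let $\widehat{F} = F[\beta]/(\beta^{p}-\beta-\alpha)$, let $h = \sum_{i=0}^{n-1}\alpha^{p^{i}}$ (a nonzero element of $\mathbb{Z}_p$), and let $\gamma = \beta^{-1}$. Then $\gamma$ is a normal element in $\widehat{F}$ over $F$, that is, $\{\gamma^{p^{in}} : 0\le i\le p-1\}$ is a basis of $\widehat{F}$ over $F$; moreover $$\gamma^{p^{in}+1} = (i h)^{-1}\gamma - (i h)^{-1}\gamma^{p^{in}} \qquad \text{for } 1\le i\le p-1,$$ and $$\gamma^{2} = \Big[\sum_{i=0}^{p-1}\gamma^{p^{in}} - \sum_{i=1}^{p-1}(i h)^{-1}\Big]\gamma + \sum_{i=1}^{p-1}(i h)^{-1}\gamma^{p^{in}}, \qquad \text{where } \sum_{i=0}^{p-1}\gamma^{p^{in}} = -\alpha^{-1}.$$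
   Context: $\mathbb{Z}_p$ denotes the prime field of integers modulo $p$. In $\widehat{F} = F[\beta]/(\beta^{p}-\beta-\alpha)$, $\beta$ also denotes the residue class of the indeterminate, so $\beta\in\widehat{F}$ is a root of $x^p-x-\alpha$. The integer $i$ in $ih$ is read modulo $p$, and $(ih)^{-1}$ is the inverse in $\mathbb{Z}_p$. *)

theory Defs
  imports "HOL-Algebra.Algebra" "HOL-Number_Theory.Residues"
begin

definition prime_field :: "nat \<Rightarrow> int ring" where
  "prime_field p = residue_ring (int p)"

definition artin_schreier_poly :: "('a, 'b) ring_scheme \<Rightarrow> nat \<Rightarrow> 'a \<Rightarrow> 'a list" where
  "artin_schreier_poly F p \<alpha> =
     X\<^bsub>F\<^esub> [^]\<^bsub>poly_ring F\<^esub> p \<ominus>\<^bsub>poly_ring F\<^esub> X\<^bsub>F\<^esub> \<ominus>\<^bsub>poly_ring F\<^esub> ring.poly_of_const F \<alpha>"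

definition artin_schreier_ext :: "('a, 'b) ring_scheme \<Rightarrow> nat \<Rightarrow> 'a \<Rightarrow> 'a list set ring" where
  "artin_schreier_ext F p \<alpha> = Rupt\<^bsub>F\<^esub> (carrier F) (artin_schreier_poly F p \<alpha>)"

definition artin_schreier_root :: "('a, 'b) ring_scheme \<Rightarrow> nat \<Rightarrow> 'a \<Rightarrow> 'a list set" where
  "artin_schreier_root F p \<alpha> = ring.rupture_surj F (carrier F) (artin_schreier_poly F p \<alpha>) X\<^bsub>F\<^esub>"

definition artin_schreier_emb :: "('a, 'b) ring_scheme \<Rightarrow> nat \<Rightarrow> 'a \<Rightarrow> 'a \<Rightarrow> 'a list set" where
  "artin_schreier_emb F p \<alpha> a =
     ring.rupture_surj F (carrier F) (artin_schreier_poly F p \<alpha>) (ring.poly_of_const F a)"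

text \<open>The library predicate \<open>independent\<close> rejects lists with repeated entries, so a basis listed
  by \<open>us\<close> consists of \<open>length us\<close> distinct vectors.\<close>

definition is_basis :: "('a, 'b) ring_scheme \<Rightarrow> 'a set \<Rightarrow> 'a list \<Rightarrow> bool" where
  "is_basis L K us \<longleftrightarrow> ring.independent L K us \<and> ring.Span L K us = carrier L"

end

(*
  Write q = p^n and P for the image of Z_p in F. For j in P,
  (beta + j)^p = (beta + j) + alpha, hence
    alpha / (beta + j) = (beta + j)^(p-1) - 1 = E_j(beta),  E_j(X) = (X + j)^(p-1) - 1.
  By Fermat, E_j(-k) is -1 if j = k and 0 otherwise for k in P, so up to sign the E_j are a
  Lagrange basis. A polynomial over F of degree < p is determined by its values on P and
  vanishes at beta only if it is zero; hence the 1 / (beta + j) are linearly independent over F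
  and sum to -1 / alpha. Iterating Frobenius gives beta^(q^i) = beta + i h, so these elements are
  the conjugates of gamma, and the product formulas are partial fraction decompositions.
  Further, h is in P since Frobenius commutes with x -> x^q on beta, and h is nonzero since
  otherwise beta would be a root of x^q - x, all of whose q roots lie in F.
*)
theory Submission
  imports Defs
begin

section \<open>Frobenius, finite fields and polynomials\<close>

text \<open>Pascal's rule carries the induction: \<open>u\<close> and \<open>v\<close> are the terms
  of the expansion for \<open>n\<close> multiplied by \<open>x\<close> and by \<open>y\<close>, and
  aligning the powers of \<open>x\<close> merges them.\<close>

lemma (in cring) binomial_expansion:
  assumes x: "x \<in> carrier R" and y: "y \<in> carrier R"
  shows "(x \<oplus> y) [^] n = (\<Oplus>k\<in>{..n}. add_pow R (n choose k) (x [^] k \<otimes> y [^] (n - k)))"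
proof (induction n)
  case 0
  show ?case by simp
next
  case (Suc n)
  define u where "u k = add_pow R (n choose k) (x [^] Suc k \<otimes> y [^] (n - k))" for k
  define v where "v k = add_pow R (n choose k) (x [^] k \<otimes> y [^] (Suc n - k))" for k
  have uv: "u k \<in> carrier R" "v k \<in> carrier R" for k
    using x y unfolding u_def v_def by auto
  have mx: "x \<otimes> add_pow R (n choose k) (x [^] k \<otimes> y [^] (n - k)) = u k" for k
    using x y unfolding u_def by (simp add: add_pow_rdistr m_ac)
  have my: "y \<otimes> add_pow R (n choose k) (x [^] k \<otimes> y [^] (n - k)) = v k" if "k \<le> n" for k
    using x y that unfolding v_def by (simp add: add_pow_rdistr m_ac Suc_diff_le)
  have "(x \<oplus> y) [^] Suc n = (x \<oplus> y) \<otimes> (x \<oplus> y) [^] n"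
    using x y by (simp add: m_comm)
  also have "\<dots> = (\<Oplus>k\<in>{..n}. u k) \<oplus> (\<Oplus>k\<in>{..n}. v k)"
  proof -
    have "x \<otimes> (x \<oplus> y) [^] n = (\<Oplus>k\<in>{..n}. u k)"
      unfolding Suc.IH mx[symmetric] using x y by (intro finsum_rdistr) auto
    moreover have "y \<otimes> (x \<oplus> y) [^] n = (\<Oplus>k\<in>{..n}. y \<otimes> add_pow R (n choose k) (x [^] k \<otimes> y [^] (n - k)))"
      unfolding Suc.IH using x y by (intro finsum_rdistr) auto
    moreover have "\<dots> = (\<Oplus>k\<in>{..n}. v k)"
      using uv my by (intro finsum_cong') auto
    ultimately show ?thesis using x y by (simp add: l_distr)
  qed
  \<comment> \<open>The added term vanishes because \<open>n choose Suc n\<close> is 0; it allows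
    the index of \<open>v\<close> to be shifted so that it meets that of \<open>u\<close>.\<close>
  also have "(\<Oplus>k\<in>{..n}. v k) = (\<Oplus>k\<in>{..Suc n}. v k)"
    using uv x y by (simp add: Pi_def) (simp add: v_def binomial_eq_0)
  also have "\<dots> = (\<Oplus>k\<in>{..n}. v (Suc k)) \<oplus> v 0"
    using uv by (subst finsum_Suc2) (auto simp: Pi_def)
  also have "(\<Oplus>k\<in>{..n}. u k) \<oplus> ((\<Oplus>k\<in>{..n}. v (Suc k)) \<oplus> v 0)
      = (\<Oplus>k\<in>{..n}. u k \<oplus> v (Suc k)) \<oplus> v 0"
    using uv by (simp add: finsum_addf Pi_def a_assoc)
  also have "\<dots> = (\<Oplus>k\<in>{..Suc n}. add_pow R (Suc n choose k) (x [^] k \<otimes> y [^] (Suc n - k)))"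
    using x y by (subst finsum_Suc2) (auto simp: u_def v_def Pi_def add.nat_pow_mult)
  finally show ?case .
qed

text \<open>The prime p divides every binomial coefficient strictly between the two ends, and p-fold
  multiples vanish, so only the end terms survive.\<close>

lemma (in cring) prime_char_pow_add:
  assumes p: "Factorial_Ring.prime p" and char: "add_pow R p \<one> = \<zero>"
    and x: "x \<in> carrier R" and y: "y \<in> carrier R"
  shows "(x \<oplus> y) [^] (p::nat) = x [^] p \<oplus> y [^] p"
proof -
  \<comment> \<open>With two successors visible, both end terms split off and the inner ones are
    indexed by \<open>Suc k\<close> with \<open>k \<le> m\<close>.\<close>
  obtain m where m: "p = Suc (Suc m)"
    using prime_ge_2_nat[OF p] that[of "p - 2"] by simp
  define t where "t k = add_pow R (p choose k) (x [^] k \<otimes> y [^] (p - k))" for k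
  have t: "t k \<in> carrier R" for k
    unfolding t_def using x y by simp
  have "add_pow R p z = \<zero>" if z: "z \<in> carrier R" for z
    using add_pow_ldistr[OF one_closed z, of p] z char by simp
  hence t0: "t (Suc k) = \<zero>" if "k \<le> m" for k
  proof -
    have "p dvd p choose Suc k"
      using that m by (intro dvd_choose_prime p) auto
    then obtain c where "p choose Suc k = p * c" by (elim dvdE)
    thus ?thesis
      unfolding t_def using x y \<open>\<And>z. z \<in> carrier R \<Longrightarrow> add_pow R p z = \<zero>\<close>
      by (simp add: add.nat_pow_pow[symmetric])
  qed
  have "(x \<oplus> y) [^] p = (\<Oplus>k\<in>{..Suc (Suc m)}. t k)"
    unfolding binomial_expansion[OF x y] t_def m ..
  also have "\<dots> = t (Suc (Suc m)) \<oplus> ((\<Oplus>k\<in>{..m}. t (Suc k)) \<oplus> t 0)"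
    using t by (subst finsum_Suc, simp, subst finsum_Suc2) auto
  also have "(\<Oplus>k\<in>{..m}. t (Suc k)) = \<zero>"
    using t0 by (intro add.finprod_one_eqI) auto
  also have "t (Suc (Suc m)) \<oplus> (\<zero> \<oplus> t 0) = x [^] p \<oplus> y [^] p"
    using x y unfolding t_def m[symmetric] by simp
  finally show ?thesis .
qed

lemma (in cring) prime_char_pow_power_add:
  assumes p: "Factorial_Ring.prime p" and char: "add_pow R p \<one> = \<zero>"
    and x: "x \<in> carrier R" and y: "y \<in> carrier R"
  shows "(x \<oplus> y) [^] (p ^ k :: nat) = x [^] (p ^ k) \<oplus> y [^] (p ^ k)"
proof (induction k)
  case 0
  show ?case using x y by simp
next
  case (Suc k)
  have "(x \<oplus> y) [^] (p ^ Suc k) = ((x \<oplus> y) [^] (p ^ k)) [^] p"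
    using x y by (simp add: nat_pow_pow mult.commute)
  also have "\<dots> = (x [^] (p ^ k)) [^] p \<oplus> (y [^] (p ^ k)) [^] p"
    unfolding Suc.IH using x y by (simp add: prime_char_pow_add[OF p char])
  finally show ?case using x y by (simp add: nat_pow_pow mult.commute)
qed

text \<open>Induction on the dimension: with \<open>v\<close> outside \<open>E'\<close>, the map
  from (k, e) to kv + e is a bijection from K x E' onto the line extension. This yields the sizes of
  \<open>F\<close> and \<open>P\<close> relative to each other and the finiteness of the extension
  field.\<close>

lemma (in ring) card_dimension:
  assumes K: "subfield K R" "finite K" and dim: "dimension n K E"
  shows "finite E \<and> card E = card K ^ n"
  using dim
proof (induction n arbitrary: E)
  case 0
  thus ?case using dimension_zero[OF K(1) 0] by simp
next
  case (Suc n)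
  obtain v E' where v: "v \<in> carrier R" "v \<notin> E'" and E': "dimension n K E'"
    and E: "E = line_extension K v E'"
    using dimension_backwards[OF K(1) Suc.prems] by auto
  note sp = space_subgroup_props[OF K(1) E']
  have KR: "K \<subseteq> carrier R" using subfieldE(3)[OF K(1)] .
  have "E = (\<lambda>(k, e). k \<otimes> v \<oplus> e) ` (K \<times> E')"
    unfolding E by (fastforce simp: line_extension_mem_iff image_iff)
  moreover have "inj_on (\<lambda>(k, e). k \<otimes> v \<oplus> e) (K \<times> E')"
  proof (rule inj_onI, clarify)
    fix k e k' e'
    assume k: "k \<in> K" "k' \<in> K" and e: "e \<in> E'" "e' \<in> E'"
      and eq: "k \<otimes> v \<oplus> e = k' \<otimes> v \<oplus> e'"
    have c: "k \<in> carrier R" "k' \<in> carrier R" "e \<in> carrier R" "e' \<in> carrier R"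
      using k e KR sp(1) by auto
    have "(k \<ominus> k') \<otimes> v = (k \<otimes> v \<oplus> e) \<ominus> e \<ominus> k' \<otimes> v"
      using c v by algebra
    also have "\<dots> = e' \<oplus> \<ominus> e"
      unfolding eq using c v by algebra
    finally have mem: "(k \<ominus> k') \<otimes> v \<in> E'"
      using sp(3,4) e by simp
    have "k \<ominus> k' \<in> K"
      using k subringE(5,7)[OF subfieldE(1)[OF K(1)]] by (simp add: a_minus_def)
    \<comment> \<open>A nonzero scalar could be divided out, which would put \<open>v\<close> itself
      into \<open>E'\<close>.\<close>
    with mem v sp(6)[of "k \<ominus> k'" v] have "k \<ominus> k' = \<zero>"
      by auto
    hence "k = k'" using c by simp
    with eq c v show "k = k' \<and> e = e'" by simp
  qed
  ultimately show ?case
    using Suc.IH[OF E'] K(2) by (simp add: card_image card_cartesian_product)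
qed

text \<open>For nonzero elements this is Lagrange's theorem in the multiplicative group.\<close>

lemma (in field) pow_card_carrier_eq:
  assumes fin: "finite (carrier R)" and x: "x \<in> carrier R"
  shows "x [^] card (carrier R) = x"
proof (cases "x = \<zero>")
  case True
  moreover have "card (carrier R) \<noteq> 0"
    using fin zero_closed by (auto simp: card_eq_0_iff)
  ultimately show ?thesis by (simp add: nat_pow_zero)
next
  case False
  have c: "card (carrier R) = Suc (order (Multiplicative_Group.mult_of R))"
    unfolding order_def using card_Suc_Diff1[OF fin zero_closed] by simp
  have "x [^]\<^bsub>Multiplicative_Group.mult_of R\<^esub> order (Multiplicative_Group.mult_of R) = \<one>\<^bsub>Multiplicative_Group.mult_of R\<^esub>"
    using x False by (intro group.pow_order_eq_1[OF field_mult_group]) auto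
  hence "x [^] order (Multiplicative_Group.mult_of R) = \<one>"
    by (simp add: Multiplicative_Group.nat_pow_mult_of)
  thus ?thesis using x unfolding c by simp
qed

text \<open>The nonzero solutions of y^q = y are roots of y^(q-1) = 1, of which a domain has at most
  q - 1. Together with zero, \<open>S\<close> already lists q solutions, so there is no room for
  another one.\<close>

lemma (in domain) fixed_pow_mem:
  assumes fin: "finite (carrier R)" and q: "q \<ge> 2"
    and S: "S \<subseteq> carrier R" "\<And>s. s \<in> S \<Longrightarrow> s [^] (q::nat) = s" "card S = q" "\<zero> \<in> S"
    and x: "x \<in> carrier R" "x [^] q = x"
  shows "x \<in> S"
proof (rule ccontr)
  assume "x \<notin> S"
  have root: "s [^] (q - 1) = \<one>" if s: "s \<in> carrier R" "s [^] q = s" "s \<noteq> \<zero>" for s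
  proof -
    have "s \<otimes> s [^] (q - 1) = s \<otimes> \<one>"
      using s q by (metis Suc_diff_1 nat_pow_Suc2 less_le_trans pos2 r_one)
    thus ?thesis using s m_lcancel nat_pow_closed one_closed by blast
  qed
  \<comment> \<open>Since zero lies in \<open>S\<close>, the element \<open>x\<close> outside
    \<open>S\<close> is nonzero; exchanging zero for \<open>x\<close> gives q nonzero
    solutions.\<close>
  have "insert x (S - {\<zero>}) \<subseteq> {y \<in> carrier R. y [^] (q - 1) = \<one>}"
    using root S x \<open>x \<notin> S\<close> by auto
  moreover have "card (insert x (S - {\<zero>})) = q"
    using S q \<open>x \<notin> S\<close> finite_subset[OF S(1) fin] by (simp add: card_Diff_singleton)
  moreover have "card {y \<in> carrier R. y [^] (q - 1) = \<one>} \<le> q - 1"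
    using q by (intro num_roots_le_deg[OF fin]) simp
  ultimately have "q \<le> q - 1"
    using fin by (metis (no_types, lifting) card_mono finite_Collect_conjI finite_subset le_trans mem_Collect_eq subsetI)
  thus False using q by simp
qed

text \<open>This is the uniqueness half of interpolation. Polynomials are coefficient lists, and
  \<open>[]\<close> is the zero polynomial.\<close>

lemma (in field) polynomial_zeroI:
  assumes g: "g \<in> carrier (poly_ring R)" and S: "S \<subseteq> carrier R" "finite S" "degree g < card S"
    and root: "\<And>s. s \<in> S \<Longrightarrow> eval g s = \<zero>"
  shows "g = []"
proof (rule ccontr)
  assume "g \<noteq> []"
  hence "S \<subseteq> set_mset (roots g)"
    using S root by (auto simp: roots_mem_iff_is_root[OF g] is_root_def)
  hence "card S \<le> size (roots g)"
    using mset_set_set_mset_msubset[of "roots g"]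
    by (metis card_mono finite_set_mset le_trans size_mset_mono size_mset_set)
  thus False using size_roots_le_degree[OF g] S(3) by simp
qed

text \<open>Bridges the list-based linear combinations behind \<open>independent\<close> and the
  finite sums used in the algebra. The induction runs from the right because \<open>[0..<m]\<close>
  grows at its right end.\<close>

lemma (in ring) combine_map_upt:
  assumes "\<And>i. f i \<in> carrier R" "set Ks \<subseteq> carrier R" "length Ks = m"
  shows "combine Ks (map f [0..<m]) = (\<Oplus>i\<in>{..<m}. Ks ! i \<otimes> f i)"
  using assms(2,3)
proof (induction Ks arbitrary: m rule: rev_induct)
  case Nil
  thus ?case by simp
next
  case (snoc k Ks)
  have m: "m = Suc (length Ks)" using snoc.prems by simp
  have "combine (Ks @ [k]) (map f [0..<m]) = combine Ks (map f [0..<length Ks]) \<oplus> combine [k] [f (length Ks)]"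
    unfolding m using snoc.prems(1) assms(1)
      combine_append[of Ks "map f [0..<length Ks]" "[k]" "[f (length Ks)]"]
    by (simp add: image_subset_iff del: combine.simps)
  also have "\<dots> = (\<Oplus>i\<in>{..<length Ks}. Ks ! i \<otimes> f i) \<oplus> k \<otimes> f (length Ks)"
    using snoc assms(1) by simp
  also have "(\<Oplus>i\<in>{..<length Ks}. Ks ! i \<otimes> f i) = (\<Oplus>i\<in>{..<length Ks}. (Ks @ [k]) ! i \<otimes> f i)"
    using snoc.prems assms(1) by (intro finsum_cong') (auto simp: nth_append subset_iff)
  finally show ?case
    using snoc.prems assms(1)
    by (auto simp: lessThan_Suc nth_append Pi_def a_comm subset_iff)
qed

lemma (in ring_hom_ring) hom_add_pow:
  "x \<in> carrier R \<Longrightarrow> h (add_pow R (k::nat) x) = add_pow S k (h x)"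
  by (induction k) simp_all

lemma (in domain) degree_finsum_le:
  assumes "finite A" "\<And>i. i \<in> A \<Longrightarrow> f i \<in> carrier (poly_ring R)"
    and "\<And>i. i \<in> A \<Longrightarrow> degree (f i) \<le> d"
  shows "degree (finsum (poly_ring R) f A) \<le> d"
  using assms
proof (induction A rule: finite_induct)
  case empty
  interpret UP: domain "poly_ring R"
    using univ_poly_is_domain[OF carrier_is_subring] .
  show ?case by (simp add: univ_poly_zero)
next
  case (insert i A)
  interpret UP: domain "poly_ring R"
    using univ_poly_is_domain[OF carrier_is_subring] .
  have "finsum (poly_ring R) f (insert i A) = f i \<oplus>\<^bsub>poly_ring R\<^esub> finsum (poly_ring R) f A"
    using insert by (intro UP.finsum_insert) auto
  moreover have "degree (finsum (poly_ring R) f A) \<le> d" "degree (f i) \<le> d"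
    using insert by auto
  ultimately show ?case
    unfolding univ_poly_add using poly_add_degree[of "f i" "finsum (poly_ring R) f A"] by simp
qed

section \<open>Interpolation at the prime subfield\<close>

text \<open>Residues modulo p are not literally elements of \<open>F\<close>, so the inclusion of
  Z_p is a homomorphism \<open>\<phi>\<close>. It is injective because its domain is a field, and
  its image \<open>P\<close> is the prime subfield.\<close>

locale prime_residue_hom = field F for F :: "('a, 'b) ring_scheme" (structure) +
  fixes p :: nat and \<phi> :: "int \<Rightarrow> 'a"
  assumes p_prime: "Factorial_Ring.prime p"
    and \<phi>_hom: "\<phi> \<in> ring_hom (prime_field p) F"
begin

definition P :: "'a set" where "P = \<phi> ` carrier (prime_field p)"

sublocale Z: residues_prime p "prime_field p"
  by unfold_locales (use p_prime prime_field_def in auto)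

sublocale \<phi>: ring_hom_ring "prime_field p" F \<phi>
  using Z.ring_axioms ring_axioms \<phi>_hom by (rule ring_hom_ringI2)

lemma inj_\<phi>: "inj_on \<phi> (carrier (prime_field p))" and subfield_P: "subfield P F"
  using \<phi>.img_is_subfield[OF Z.carrier_is_subfield] one_not_zero unfolding P_def by auto

lemma card_prime_field: "card (carrier (prime_field p)) = p"
  by (simp add: Z.res_carrier_eq)

lemma finite_P: "finite P" and card_P: "card P = p"
  unfolding P_def using card_image[OF inj_\<phi>] card_prime_field by simp_all

lemma P_carrier: "P \<subseteq> carrier F"
  using subfieldE(3)[OF subfield_P] .

lemma P_closed:
  "\<zero> \<in> P" "x \<in> P \<Longrightarrow> \<ominus> x \<in> P" "x \<in> P \<Longrightarrow> y \<in> P \<Longrightarrow> x \<oplus> y \<in> P"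
  using subringE[OF subfieldE(1)[OF subfield_P]] by auto

text \<open>Fermat's little theorem, proved in \<open>prime_field p\<close>, which has p elements,
  and carried over by \<open>\<phi>\<close>.\<close>

lemma P_pow:
  assumes "x \<in> P"
  shows "x [^] p = x"
proof -
  obtain z where z: "z \<in> carrier (prime_field p)" "x = \<phi> z"
    using assms unfolding P_def by auto
  show ?thesis
    using Z.pow_card_carrier_eq[OF Z.finite z(1)] z
    by (simp add: card_prime_field \<phi>.hom_nat_pow[symmetric])
qed

lemma P_pow_minus_one:
  assumes "x \<in> P" "x \<noteq> \<zero>"
  shows "x [^] (p - 1) = \<one>"
proof -
  have x: "x \<in> carrier F" using assms P_carrier by auto
  have "x \<otimes> x [^] (p - 1) = x \<otimes> \<one>"
    using P_pow[OF assms(1)] x prime_gt_0_nat[OF p_prime] by (metis Suc_diff_1 nat_pow_Suc2 r_one)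
  thus ?thesis using x assms(2) m_lcancel nat_pow_closed one_closed by blast
qed

text \<open>Taking k = p gives characteristic p; general k later turns the product ih in Z_p into a
  natural multiple in \<open>F\<close>.\<close>

lemma \<phi>_of_nat: "\<phi> (int k mod int p) = add_pow F k \<one>"
proof (induction k)
  case 0
  show ?case using \<phi>.hom_zero by (simp add: Z.res_zero_eq)
next
  case (Suc k)
  have "int (Suc k) mod int p = (int k mod int p) \<oplus>\<^bsub>prime_field p\<^esub> \<one>\<^bsub>prime_field p\<^esub>"
    by (simp add: Z.one_cong Z.add_cong add.commute)
  thus ?case using Suc.IH by simp
qed

lemma char: "add_pow F p \<one> = \<zero>"
  using \<phi>_of_nat[of p] \<phi>.hom_zero by (simp add: Z.res_zero_eq)

section \<open>Interpolating polynomials over \<open>F\<close>\<close>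

abbreviation const :: "'a \<Rightarrow> 'a list" where "const \<equiv> poly_of_const"

sublocale UP: domain "poly_ring F"
  using univ_poly_is_domain[OF carrier_is_subring] .

lemma const_closed [simp]: "a \<in> carrier F \<Longrightarrow> const a \<in> carrier (poly_ring F)"
  using canonical_embedding_is_hom[OF carrier_is_subring] by (auto dest: ring_hom_memE(1))

lemma X_closed [simp]: "X \<in> carrier (poly_ring F)"
  using var_closed(1)[OF carrier_is_subring] .

lemma eval_const: "a \<in> carrier F \<Longrightarrow> eval (const a) x = a"
  by (auto simp: poly_of_const_def)

lemma degree_const: "degree (const a) = 0"
  by (auto simp: poly_of_const_def)

text \<open>For j in \<open>P\<close> this is E_j: on \<open>P\<close> it is minus the indicator
  function of the point -j, while at \<beta> it becomes \<alpha> / (\<beta> + j).\<close>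

definition lagrange :: "'a \<Rightarrow> 'a list" where
  "lagrange j = (X \<oplus>\<^bsub>poly_ring F\<^esub> const j) [^]\<^bsub>poly_ring F\<^esub> (p - 1) \<ominus>\<^bsub>poly_ring F\<^esub> \<one>\<^bsub>poly_ring F\<^esub>"

lemma lagrange_closed [simp]: "j \<in> carrier F \<Longrightarrow> lagrange j \<in> carrier (poly_ring F)"
  unfolding lagrange_def by simp

lemma degree_lagrange:
  assumes "j \<in> carrier F"
  shows "degree (lagrange j) \<le> p - 1"
proof -
  let ?l = "X \<oplus>\<^bsub>poly_ring F\<^esub> const j"
  have "degree ?l \<le> 1"
    using poly_add_degree[of X "const j"] degree_const by (simp add: univ_poly_add var_def)
  hence "degree (?l [^]\<^bsub>poly_ring F\<^esub> (p - 1)) \<le> p - 1"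
    using assms polynomial_pow_degree[of ?l "p - 1"] by simp
  moreover have "degree (\<ominus>\<^bsub>poly_ring F\<^esub> \<one>\<^bsub>poly_ring F\<^esub>) = 0"
    using univ_poly_a_inv_degree[OF carrier_is_subring UP.one_closed] by (simp add: univ_poly_one)
  ultimately show ?thesis
    unfolding lagrange_def a_minus_def univ_poly_add
    using poly_add_degree[of "?l [^]\<^bsub>poly_ring F\<^esub> (p - 1)" "\<ominus>\<^bsub>poly_ring F\<^esub> \<one>\<^bsub>poly_ring F\<^esub>"]
    by (simp add: univ_poly_add)
qed

lemma eval_lagrange:
  assumes "j \<in> P" "k \<in> P"
  shows "eval (lagrange j) (\<ominus> k) = (if j = k then \<ominus> \<one> else \<zero>)"
proof -
  have c: "j \<in> carrier F" "k \<in> carrier F" using assms P_carrier by auto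
  interpret ev: ring_hom_ring "poly_ring F" F "\<lambda>g. eval g (\<ominus> k)"
    using eval_ring_hom[OF carrier_is_subring, of "\<ominus> k"] c by simp
  have "eval (lagrange j) (\<ominus> k) = (\<ominus> k \<oplus> j) [^] (p - 1) \<ominus> \<one>"
    unfolding lagrange_def a_minus_def using c
    by (simp add: ev.hom_nat_pow eval_var eval_const)
  also have "\<dots> = (if j = k then \<ominus> \<one> else \<zero>)"
  proof (cases "j = k")
    case True
    \<comment> \<open>The exponent has to be positive, since the zeroth power of zero is
      one.\<close>
    moreover have "p - 1 \<noteq> 0" using prime_ge_2_nat[OF p_prime] by simp
    ultimately show ?thesis using c by (simp add: l_neg nat_pow_zero minus_eq)
  next
    case False
    hence "\<ominus> k \<oplus> j \<noteq> \<zero>" using c by (metis a_comm a_inv_closed minus_equality minus_minus)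
    hence "(\<ominus> k \<oplus> j) [^] (p - 1) = \<one>"
      using assms P_closed by (intro P_pow_minus_one) auto
    thus ?thesis using False by (simp add: minus_eq r_neg)
  qed
  finally show ?thesis .
qed

text \<open>The sign of \<open>lagrange\<close> is left in place: the value at -k is minus
  \<open>a k\<close>, and in exchange the coefficients reappear unchanged in the partial fraction
  sum of \<open>\<sigma>_interpolate\<close>.\<close>

definition interpolate :: "('a \<Rightarrow> 'a) \<Rightarrow> 'a list" where
  "interpolate a = (\<Oplus>\<^bsub>poly_ring F\<^esub>j\<in>P. const (a j) \<otimes>\<^bsub>poly_ring F\<^esub> lagrange j)"

context
  fixes a assumes a: "a \<in> P \<rightarrow> carrier F"
begin

lemma interpolate_term_closed: "j \<in> P \<Longrightarrow> const (a j) \<otimes>\<^bsub>poly_ring F\<^esub> lagrange j \<in> carrier (poly_ring F)"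
  using a P_carrier by (intro UP.m_closed const_closed lagrange_closed) auto

lemma interpolate_closed: "interpolate a \<in> carrier (poly_ring F)"
  unfolding interpolate_def using interpolate_term_closed by (intro UP.finsum_closed) auto

lemma degree_interpolate: "degree (interpolate a) \<le> p - 1"
  unfolding interpolate_def
proof (rule degree_finsum_le[OF finite_P interpolate_term_closed])
  fix j assume j: "j \<in> P"
  have "polynomial (carrier F) (const (a j))" "polynomial (carrier F) (lagrange j)"
    using j a P_carrier by (auto simp: univ_poly_carrier Pi_iff)
  hence "degree (const (a j) \<otimes>\<^bsub>poly_ring F\<^esub> lagrange j) \<le> degree (lagrange j)"
    unfolding univ_poly_mult poly_mult_degree_eq[OF carrier_is_subring \<open>polynomial _ (const (a j))\<close> \<open>polynomial _ (lagrange j)\<close>]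
    using degree_const by simp
  thus "degree (const (a j) \<otimes>\<^bsub>poly_ring F\<^esub> lagrange j) \<le> p - 1"
    using degree_lagrange[of j] j P_carrier by auto
qed

lemma eval_interpolate:
  assumes k: "k \<in> P"
  shows "eval (interpolate a) (\<ominus> k) = \<ominus> (a k)"
proof -
  have kc: "k \<in> carrier F" using k P_carrier by auto
  interpret ev: ring_hom_ring "poly_ring F" F "\<lambda>g. eval g (\<ominus> k)"
    using eval_ring_hom[OF carrier_is_subring, of "\<ominus> k"] kc by simp
  have "eval (interpolate a) (\<ominus> k) = (\<Oplus>j\<in>P. eval (const (a j) \<otimes>\<^bsub>poly_ring F\<^esub> lagrange j) (\<ominus> k))"
    unfolding interpolate_def using interpolate_term_closed by (subst ev.hom_finsum) (auto simp: o_def)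
  also have "\<dots> = (\<Oplus>j\<in>P. if k = j then \<ominus> (a j) else \<zero>)"
  proof (rule finsum_cong', rule refl)
    fix j assume j: "j \<in> P"
    have c: "j \<in> carrier F" "a j \<in> carrier F" using j a P_carrier by auto
    show "eval (const (a j) \<otimes>\<^bsub>poly_ring F\<^esub> lagrange j) (\<ominus> k) = (if k = j then \<ominus> (a j) else \<zero>)"
      using c j k by (simp add: eval_const eval_lagrange r_minus)
  qed (use a in \<open>auto simp: Pi_iff\<close>)
  also have "\<dots> = \<ominus> (a k)"
    using k a finite_P by (intro add.finprod_singleton) (auto simp: Pi_iff)
  finally show ?thesis .
qed

end

end

section \<open>Artin-Schreier extensions\<close>

text \<open>The map \<open>\<sigma>\<close> is evaluation at \<open>\<beta>\<close>; in the application it is the quotient map onto the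
  rupture field.\<close>

locale artin_schreier_extension =
  prime_residue_hom F p \<phi> + L: field L + \<iota>: ring_hom_ring F L \<iota> + \<sigma>: ring_hom_ring "poly_ring F" L \<sigma>
  for F :: "('a, 'b) ring_scheme" (structure) and p \<phi>
    and L :: "('c, 'd) ring_scheme" and \<iota> \<sigma> +
  fixes n :: nat and \<alpha> :: 'a and \<beta> :: 'c
  assumes dim: "dimension n P (carrier F)" and n_pos: "n \<ge> 1"
    and \<alpha>: "\<alpha> \<in> carrier F" "\<alpha> \<noteq> \<zero>"
    and \<sigma>_X: "\<sigma> X = \<beta>"
    and \<sigma>_const: "\<And>a. a \<in> carrier F \<Longrightarrow> \<sigma> (const a) = \<iota> a"
    and \<sigma>_zeroD: "\<And>g. g \<in> carrier (poly_ring F) \<Longrightarrow> degree g < p \<Longrightarrow> \<sigma> g = \<zero>\<^bsub>L\<^esub> \<Longrightarrow> g = []"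
    and \<beta>_pow: "\<beta> [^]\<^bsub>L\<^esub> p = \<beta> \<oplus>\<^bsub>L\<^esub> \<iota> \<alpha>"
    and L_dim: "L.dimension p (\<iota> ` carrier F) (carrier L)"
begin

lemma inj_\<iota>: "inj_on \<iota> (carrier F)" and subfield_\<iota>: "subfield (\<iota> ` carrier F) L"
  using \<iota>.img_is_subfield[OF carrier_is_subfield] L.one_not_zero by auto

lemma \<iota>_eq_iff: "x \<in> carrier F \<Longrightarrow> y \<in> carrier F \<Longrightarrow> \<iota> x = \<iota> y \<longleftrightarrow> x = y"
  using inj_\<iota> by (auto dest: inj_onD)

lemma \<iota>_eq_zero_iff: "x \<in> carrier F \<Longrightarrow> \<iota> x = \<zero>\<^bsub>L\<^esub> \<longleftrightarrow> x = \<zero>"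
  using \<iota>_eq_iff[of x \<zero>] by simp

lemma finite_F: "finite (carrier F)" and card_F: "card (carrier F) = p ^ n"
  using card_dimension[OF subfield_P finite_P dim] card_P by auto

lemma finite_L: "finite (carrier L)"
  using L.card_dimension[OF subfield_\<iota> _ L_dim] finite_F by auto

lemma F_pow: "x \<in> carrier F \<Longrightarrow> x [^] (p ^ n) = x"
  using pow_card_carrier_eq[OF finite_F] card_F by simp

lemma \<beta>_closed [simp]: "\<beta> \<in> carrier L"
  using \<sigma>.hom_closed[OF X_closed] \<sigma>_X by simp

lemma L_char: "add_pow L p \<one>\<^bsub>L\<^esub> = \<zero>\<^bsub>L\<^esub>"
  using \<iota>.hom_add_pow[of \<one> p] char by simp

lemmas L_pow_add = L.prime_char_pow_add[OF p_prime L_char]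
lemmas L_pow_power_add = L.prime_char_pow_power_add[OF p_prime L_char]

text \<open>Frobenius is additive and fixes j, so every translate of \<beta> by \<open>P\<close> is
  again a root of x^p - x - \<alpha>.\<close>

lemma \<beta>_plus_pow:
  assumes "j \<in> P"
  shows "(\<beta> \<oplus>\<^bsub>L\<^esub> \<iota> j) [^]\<^bsub>L\<^esub> p = (\<beta> \<oplus>\<^bsub>L\<^esub> \<iota> j) \<oplus>\<^bsub>L\<^esub> \<iota> \<alpha>"
proof -
  have j: "j \<in> carrier F" using assms P_carrier by auto
  have "(\<beta> \<oplus>\<^bsub>L\<^esub> \<iota> j) [^]\<^bsub>L\<^esub> p = (\<beta> \<oplus>\<^bsub>L\<^esub> \<iota> \<alpha>) \<oplus>\<^bsub>L\<^esub> \<iota> j"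
    using j \<beta>_pow P_pow[OF assms] by (simp add: L_pow_add \<iota>.hom_nat_pow[symmetric])
  thus ?thesis using j \<alpha> by (simp add: L.a_ac)
qed

lemma \<beta>_plus_nonzero:
  assumes "j \<in> P"
  shows "\<beta> \<oplus>\<^bsub>L\<^esub> \<iota> j \<noteq> \<zero>\<^bsub>L\<^esub>"
proof
  assume z: "\<beta> \<oplus>\<^bsub>L\<^esub> \<iota> j = \<zero>\<^bsub>L\<^esub>"
  have "\<zero>\<^bsub>L\<^esub> = \<iota> \<alpha>"
    using \<beta>_plus_pow[OF assms] prime_gt_0_nat[OF p_prime] \<alpha> unfolding z by (simp add: L.nat_pow_zero)
  thus False using \<iota>_eq_zero_iff[OF \<alpha>(1)] \<alpha> by simp
qed

lemma inv_closed: "j \<in> P \<Longrightarrow> inv\<^bsub>L\<^esub> (\<beta> \<oplus>\<^bsub>L\<^esub> \<iota> j) \<in> carrier L"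
  and inv_mult: "j \<in> P \<Longrightarrow> inv\<^bsub>L\<^esub> (\<beta> \<oplus>\<^bsub>L\<^esub> \<iota> j) \<otimes>\<^bsub>L\<^esub> (\<beta> \<oplus>\<^bsub>L\<^esub> \<iota> j) = \<one>\<^bsub>L\<^esub>"
proof -
  assume j: "j \<in> P"
  hence "\<beta> \<oplus>\<^bsub>L\<^esub> \<iota> j \<in> Units L"
    using \<beta>_plus_nonzero[OF j] P_carrier by (auto simp: L.field_Units)
  thus "inv\<^bsub>L\<^esub> (\<beta> \<oplus>\<^bsub>L\<^esub> \<iota> j) \<in> carrier L"
    "inv\<^bsub>L\<^esub> (\<beta> \<oplus>\<^bsub>L\<^esub> \<iota> j) \<otimes>\<^bsub>L\<^esub> (\<beta> \<oplus>\<^bsub>L\<^esub> \<iota> j) = \<one>\<^bsub>L\<^esub>"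
    by simp_all
qed

lemma \<sigma>_lagrange:
  assumes j: "j \<in> P"
  shows "\<sigma> (lagrange j) = \<iota> \<alpha> \<otimes>\<^bsub>L\<^esub> inv\<^bsub>L\<^esub> (\<beta> \<oplus>\<^bsub>L\<^esub> \<iota> j)"
proof -
  let ?b = "\<beta> \<oplus>\<^bsub>L\<^esub> \<iota> j"
  have jc: "j \<in> carrier F" using j P_carrier by auto
  have b: "?b \<in> carrier L" using jc by simp
  have "\<sigma> (lagrange j) = ?b [^]\<^bsub>L\<^esub> (p - 1) \<ominus>\<^bsub>L\<^esub> \<one>\<^bsub>L\<^esub>"
    unfolding lagrange_def a_minus_def using jc by (simp add: \<sigma>.hom_nat_pow \<sigma>_X \<sigma>_const)
  \<comment> \<open>The factor \<open>?b\<close> raises the exponent to p, where the root equation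
    gives \<open>\<iota> \<alpha>\<close>; the inverse remains.\<close>
  also have "\<dots> = (?b [^]\<^bsub>L\<^esub> (p - 1) \<ominus>\<^bsub>L\<^esub> \<one>\<^bsub>L\<^esub>) \<otimes>\<^bsub>L\<^esub> (inv\<^bsub>L\<^esub> ?b \<otimes>\<^bsub>L\<^esub> ?b)"
    using b inv_mult[OF j] by simp
  also have "\<dots> = (?b [^]\<^bsub>L\<^esub> (p - 1) \<otimes>\<^bsub>L\<^esub> ?b \<ominus>\<^bsub>L\<^esub> ?b) \<otimes>\<^bsub>L\<^esub> inv\<^bsub>L\<^esub> ?b"
    using b inv_closed[OF j] L.nat_pow_closed[OF b, of "p - 1"] by algebra
  also have "?b [^]\<^bsub>L\<^esub> (p - 1) \<otimes>\<^bsub>L\<^esub> ?b = ?b [^]\<^bsub>L\<^esub> p"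
    using prime_gt_0_nat[OF p_prime] L.nat_pow_Suc[of ?b "p - 1"] by simp
  also have "?b [^]\<^bsub>L\<^esub> p \<ominus>\<^bsub>L\<^esub> ?b = \<iota> \<alpha>"
    unfolding \<beta>_plus_pow[OF j] using b \<alpha> \<iota>.hom_closed[OF \<alpha>(1)] by algebra
  finally show ?thesis .
qed

lemma \<sigma>_interpolate:
  assumes a: "a \<in> P \<rightarrow> carrier F"
  shows "\<sigma> (interpolate a) = \<iota> \<alpha> \<otimes>\<^bsub>L\<^esub> (\<Oplus>\<^bsub>L\<^esub>j\<in>P. \<iota> (a j) \<otimes>\<^bsub>L\<^esub> inv\<^bsub>L\<^esub> (\<beta> \<oplus>\<^bsub>L\<^esub> \<iota> j))"
proof -
  have "\<sigma> (interpolate a) = (\<Oplus>\<^bsub>L\<^esub>j\<in>P. \<sigma> (const (a j) \<otimes>\<^bsub>poly_ring F\<^esub> lagrange j))"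
    unfolding interpolate_def using interpolate_term_closed[OF a] by (subst \<sigma>.hom_finsum) (auto simp: o_def)
  also have "\<dots> = (\<Oplus>\<^bsub>L\<^esub>j\<in>P. \<iota> \<alpha> \<otimes>\<^bsub>L\<^esub> (\<iota> (a j) \<otimes>\<^bsub>L\<^esub> inv\<^bsub>L\<^esub> (\<beta> \<oplus>\<^bsub>L\<^esub> \<iota> j)))"
  proof (rule L.finsum_cong', rule refl)
    fix j assume j: "j \<in> P"
    have c: "j \<in> carrier F" "a j \<in> carrier F" using j a P_carrier by auto
    show "\<sigma> (const (a j) \<otimes>\<^bsub>poly_ring F\<^esub> lagrange j) = \<iota> \<alpha> \<otimes>\<^bsub>L\<^esub> (\<iota> (a j) \<otimes>\<^bsub>L\<^esub> inv\<^bsub>L\<^esub> (\<beta> \<oplus>\<^bsub>L\<^esub> \<iota> j))"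
      using c j inv_closed[OF j] \<alpha> by (simp add: \<sigma>_lagrange \<sigma>_const L.m_ac)
  qed (use a \<alpha> inv_closed in \<open>auto simp: Pi_iff\<close>)
  also have "\<dots> = \<iota> \<alpha> \<otimes>\<^bsub>L\<^esub> (\<Oplus>\<^bsub>L\<^esub>j\<in>P. \<iota> (a j) \<otimes>\<^bsub>L\<^esub> inv\<^bsub>L\<^esub> (\<beta> \<oplus>\<^bsub>L\<^esub> \<iota> j))"
    using a \<alpha> inv_closed by (intro L.finsum_rdistr[symmetric]) (auto simp: Pi_iff finite_P)
  finally show ?thesis .
qed

lemma interpolate_degree_less: "a \<in> P \<rightarrow> carrier F \<Longrightarrow> degree (interpolate a) < p"
  using degree_interpolate[of a] prime_gt_0_nat[OF p_prime] by linarith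

text \<open>A vanishing combination makes the interpolating polynomial vanish at \<beta>. Its degree
  is below p, so it is zero by \<open>\<sigma>_zeroD\<close>, and its values on \<open>P\<close>
  return the coefficients up to sign.\<close>

lemma inv_independent:
  assumes a: "a \<in> P \<rightarrow> carrier F"
    and zero: "(\<Oplus>\<^bsub>L\<^esub>j\<in>P. \<iota> (a j) \<otimes>\<^bsub>L\<^esub> inv\<^bsub>L\<^esub> (\<beta> \<oplus>\<^bsub>L\<^esub> \<iota> j)) = \<zero>\<^bsub>L\<^esub>"
    and k: "k \<in> P"
  shows "a k = \<zero>"
proof -
  have "\<sigma> (interpolate a) = \<zero>\<^bsub>L\<^esub>"
    unfolding \<sigma>_interpolate[OF a] zero using \<alpha> by simp
  hence "interpolate a = []"
    using \<sigma>_zeroD interpolate_closed[OF a] interpolate_degree_less[OF a] by blast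
  hence "\<ominus> (a k) = \<zero>"
    using eval_interpolate[OF a k] by simp
  moreover have "a k \<in> carrier F" using a k by auto
  ultimately show ?thesis by (metis minus_minus minus_zero)
qed

text \<open>With all coefficients one, the interpolating polynomial takes the value -1 on all of
  \<open>P\<close> and hence is the constant -1. Applying \<open>\<sigma>\<close> gives \<alpha>
  times the sum equal to -1.\<close>

lemma sum_inv:
  "(\<Oplus>\<^bsub>L\<^esub>j\<in>P. inv\<^bsub>L\<^esub> (\<beta> \<oplus>\<^bsub>L\<^esub> \<iota> j)) = \<iota> (\<ominus> (inv \<alpha>))"
proof -
  define a where "a = (\<lambda>j::'a. \<one>)"
  have a: "a \<in> P \<rightarrow> carrier F" unfolding a_def by simp
  define g where "g = interpolate a \<oplus>\<^bsub>poly_ring F\<^esub> \<one>\<^bsub>poly_ring F\<^esub>"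
  have g: "g \<in> carrier (poly_ring F)" unfolding g_def using interpolate_closed[OF a] by simp
  have "degree g < p"
    using poly_add_degree[of "interpolate a" "\<one>\<^bsub>poly_ring F\<^esub>"] interpolate_degree_less[OF a] prime_gt_0_nat[OF p_prime]
    unfolding g_def by (simp add: univ_poly_add univ_poly_one)
  moreover have "eval g s = \<zero>" if s: "s \<in> P" for s
  proof -
    have c: "s \<in> carrier F" using s P_carrier by auto
    interpret ev: ring_hom_ring "poly_ring F" F "\<lambda>g. eval g s"
      using eval_ring_hom[OF carrier_is_subring c] .
    \<comment> \<open>Values are known at points of the form -k; here k is -s, which is also in
      \<open>P\<close>.\<close>
    have "eval (interpolate a) s = \<ominus> \<one>"
      using eval_interpolate[OF a, of "\<ominus> s"] s c P_closed by (simp add: a_def)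
    thus ?thesis unfolding g_def using interpolate_closed[OF a] by (simp add: l_neg)
  qed
  ultimately have "g = []"
    using polynomial_zeroI[OF g P_carrier finite_P] card_P by simp
  hence "\<sigma> g = \<zero>\<^bsub>L\<^esub>"
    using \<sigma>.hom_zero by (simp add: univ_poly_zero)
  hence eq: "\<iota> \<alpha> \<otimes>\<^bsub>L\<^esub> (\<Oplus>\<^bsub>L\<^esub>j\<in>P. \<iota> \<one> \<otimes>\<^bsub>L\<^esub> inv\<^bsub>L\<^esub> (\<beta> \<oplus>\<^bsub>L\<^esub> \<iota> j)) \<oplus>\<^bsub>L\<^esub> \<one>\<^bsub>L\<^esub> = \<zero>\<^bsub>L\<^esub>"
    unfolding g_def using interpolate_closed[OF a] \<sigma>_interpolate[OF a] by (simp add: a_def)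
  define T where "T = (\<Oplus>\<^bsub>L\<^esub>j\<in>P. inv\<^bsub>L\<^esub> (\<beta> \<oplus>\<^bsub>L\<^esub> \<iota> j))"
  have T: "T \<in> carrier L" unfolding T_def using inv_closed by (intro L.finsum_closed) auto
  have "(\<Oplus>\<^bsub>L\<^esub>j\<in>P. \<iota> \<one> \<otimes>\<^bsub>L\<^esub> inv\<^bsub>L\<^esub> (\<beta> \<oplus>\<^bsub>L\<^esub> \<iota> j)) = T"
    unfolding T_def using inv_closed by (intro L.finsum_cong') auto
  with eq have eq: "\<iota> \<alpha> \<otimes>\<^bsub>L\<^esub> T \<oplus>\<^bsub>L\<^esub> \<one>\<^bsub>L\<^esub> = \<zero>\<^bsub>L\<^esub>" by simp
  have ia: "inv \<alpha> \<in> carrier F" "inv \<alpha> \<otimes> \<alpha> = \<one>" using \<alpha> by (simp_all add: field_Units)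
  hence i: "\<iota> (inv \<alpha>) \<otimes>\<^bsub>L\<^esub> \<iota> \<alpha> = \<one>\<^bsub>L\<^esub>" using \<iota>.hom_mult[of "inv \<alpha>" \<alpha>] \<alpha> by simp
  have c: "\<iota> \<alpha> \<in> carrier L" "\<iota> (inv \<alpha>) \<in> carrier L" using \<alpha> ia by auto
  have "T = \<iota> (inv \<alpha>) \<otimes>\<^bsub>L\<^esub> \<iota> \<alpha> \<otimes>\<^bsub>L\<^esub> T" using i T by simp
  also have "\<dots> = \<iota> (inv \<alpha>) \<otimes>\<^bsub>L\<^esub> (\<iota> \<alpha> \<otimes>\<^bsub>L\<^esub> T \<oplus>\<^bsub>L\<^esub> \<one>\<^bsub>L\<^esub>) \<ominus>\<^bsub>L\<^esub> \<iota> (inv \<alpha>)"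
    using T c by algebra
  also have "\<dots> = \<iota> (\<ominus> (inv \<alpha>))"
    unfolding eq using c ia by (simp add: L.minus_eq)
  finally show ?thesis unfolding T_def .
qed

section \<open>The absolute trace of \<alpha>, which is the element h seen in
  \<open>F\<close>\<close>

definition trace :: 'a where "trace = (\<Oplus>i\<in>{..<n}. \<alpha> [^] (p ^ i))"

text \<open>Raising \<beta>^p = \<beta> + \<alpha> to the power p^k contributes the next summand
  \<alpha>^(p^k).\<close>

lemma \<beta>_pow_power: "\<beta> [^]\<^bsub>L\<^esub> (p ^ k) = \<beta> \<oplus>\<^bsub>L\<^esub> \<iota> (\<Oplus>i\<in>{..<k}. \<alpha> [^] (p ^ i))"
proof (induction k)
  case 0
  show ?case by simp
next
  case (Suc k)
  have s: "(\<Oplus>i\<in>{..<k}. \<alpha> [^] (p ^ i)) \<in> carrier F"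
    using \<alpha> by (intro finsum_closed) auto
  have "\<beta> [^]\<^bsub>L\<^esub> (p ^ Suc k) = (\<beta> [^]\<^bsub>L\<^esub> p) [^]\<^bsub>L\<^esub> (p ^ k)"
    by (simp add: L.nat_pow_pow)
  also have "\<dots> = (\<beta> \<oplus>\<^bsub>L\<^esub> \<iota> (\<Oplus>i\<in>{..<k}. \<alpha> [^] (p ^ i))) \<oplus>\<^bsub>L\<^esub> \<iota> (\<alpha> [^] (p ^ k))"
    unfolding \<beta>_pow using \<alpha> by (simp add: L_pow_power_add Suc.IH \<iota>.hom_nat_pow)
  also have "\<dots> = \<beta> \<oplus>\<^bsub>L\<^esub> \<iota> (\<Oplus>i\<in>{..<Suc k}. \<alpha> [^] (p ^ i))"
  proof -
    have "(\<Oplus>i\<in>{..<Suc k}. \<alpha> [^] (p ^ i)) = \<alpha> [^] (p ^ k) \<oplus> (\<Oplus>i\<in>{..<k}. \<alpha> [^] (p ^ i))"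
      using \<alpha> by (simp add: lessThan_Suc Pi_def)
    thus ?thesis using \<alpha> s by (simp add: L.a_ac del: \<iota>.hom_finsum)
  qed
  finally show ?case .
qed

lemma trace_closed [simp]: "trace \<in> carrier F"
  unfolding trace_def using \<alpha> by (intro finsum_closed) auto

lemma \<beta>_pow_q: "\<beta> [^]\<^bsub>L\<^esub> (p ^ n) = \<beta> \<oplus>\<^bsub>L\<^esub> \<iota> trace"
  using \<beta>_pow_power[of n] unfolding trace_def .

text \<open>Computing \<beta>^(p^(n+1)) in both orders gives \<beta> + \<alpha> + h^p and \<beta> +
  h + \<alpha>, because the power p^n fixes \<alpha>. Hence h^p = h, an equation whose solutions are
  exhausted by \<open>P\<close>.\<close>

lemma trace_in_P: "trace \<in> P"
proof -
  have "\<beta> \<oplus>\<^bsub>L\<^esub> \<iota> \<alpha> \<oplus>\<^bsub>L\<^esub> \<iota> (trace [^] p) = (\<beta> [^]\<^bsub>L\<^esub> (p ^ n)) [^]\<^bsub>L\<^esub> p"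
    unfolding \<beta>_pow_q by (simp add: L_pow_add \<beta>_pow \<iota>.hom_nat_pow)
  also have "\<dots> = (\<beta> [^]\<^bsub>L\<^esub> p) [^]\<^bsub>L\<^esub> (p ^ n)"
    by (simp add: L.nat_pow_pow mult.commute)
  also have "\<dots> = \<beta> \<oplus>\<^bsub>L\<^esub> \<iota> trace \<oplus>\<^bsub>L\<^esub> \<iota> \<alpha>"
    unfolding \<beta>_pow using \<alpha> by (simp add: L_pow_power_add \<beta>_pow_q \<iota>.hom_nat_pow[symmetric] F_pow)
  also have "\<dots> = \<beta> \<oplus>\<^bsub>L\<^esub> \<iota> \<alpha> \<oplus>\<^bsub>L\<^esub> \<iota> trace"
    using \<alpha> by (simp add: L.a_ac)
  finally have "\<iota> (trace [^] p) = \<iota> trace"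
    using \<alpha> by (simp add: L.add.l_cancel)
  hence "trace [^] p = trace" by (simp add: \<iota>_eq_iff)
  thus ?thesis
    using fixed_pow_mem[OF finite_F prime_ge_2_nat[OF p_prime] P_carrier P_pow card_P P_closed(1)]
    by simp
qed

lemma \<beta>_not_in_F: "\<beta> \<notin> \<iota> ` carrier F"
proof
  assume "\<beta> \<in> \<iota> ` carrier F"
  then obtain a where a: "a \<in> carrier F" "\<beta> = \<iota> a" by auto
  let ?g = "X \<ominus>\<^bsub>poly_ring F\<^esub> const a"
  have "\<sigma> ?g = \<zero>\<^bsub>L\<^esub>"
    unfolding a_minus_def using a by (simp add: \<sigma>_X \<sigma>_const L.r_neg)
  moreover have "degree (\<ominus>\<^bsub>poly_ring F\<^esub> const a) = 0"
    using univ_poly_a_inv_degree[OF carrier_is_subring, of "const a"] a degree_const by simp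
  hence "degree ?g < p"
    using poly_add_degree[of X "\<ominus>\<^bsub>poly_ring F\<^esub> const a"] prime_ge_2_nat[OF p_prime]
    by (simp add: univ_poly_add a_minus_def var_def)
  ultimately have "?g = \<zero>\<^bsub>poly_ring F\<^esub>"
    using \<sigma>_zeroD[of ?g] a by (simp add: univ_poly_zero)
  hence "X = const a"
    using a UP.r_right_minus_eq by simp
  \<comment> \<open>As lists, \<open>X\<close> has two coefficients and a constant has at most
    one.\<close>
  thus False by (auto simp: var_def poly_of_const_def split: if_splits)
qed

lemma trace_nonzero: "trace \<noteq> \<zero>"
proof
  assume "trace = \<zero>"
  hence fixed: "\<beta> [^]\<^bsub>L\<^esub> (p ^ n) = \<beta>" using \<beta>_pow_q by simp
  have q: "2 \<le> p ^ n"
    using prime_ge_2_nat[OF p_prime] n_pos self_le_power[of p n] by linarith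
  have pow: "s [^]\<^bsub>L\<^esub> (p ^ n) = s" if "s \<in> \<iota> ` carrier F" for s
    using that F_pow by (auto simp: \<iota>.hom_nat_pow[symmetric])
  have z: "\<zero>\<^bsub>L\<^esub> \<in> \<iota> ` carrier F"
    using \<iota>.hom_zero by (metis imageI zero_closed)
  \<comment> \<open>The image of \<open>F\<close> consists of p^n fixed points of the power p^n, so
    it contains every such fixed point, including \<beta>.\<close>
  have "\<beta> \<in> \<iota> ` carrier F"
    by (rule L.fixed_pow_mem[OF finite_L q _ pow _ z \<beta>_closed fixed])
      (auto simp: card_image[OF inj_\<iota>] card_F)
  thus False using \<beta>_not_in_F by simp
qed

end

section \<open>The conjugates of \<gamma> and normality\<close>

context artin_schreier_extension
begin

text \<open>This is ih in \<open>F\<close>, as a natural multiple: each further power p^n of \<beta>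
  adds one more \<open>trace\<close>.\<close>

definition shift :: "nat \<Rightarrow> 'a" where "shift i = add_pow F i trace"

lemma shift_in_P: "shift i \<in> P"
  unfolding shift_def by (induction i) (use P_closed trace_in_P in auto)

lemma shift_closed [simp]: "shift i \<in> carrier F"
  using shift_in_P P_carrier by auto

text \<open>A preimage exists by \<open>trace_in_P\<close> and is unique because
  \<open>\<phi>\<close> is injective.\<close>

definition h :: int where "h = inv_into (carrier (prime_field p)) \<phi> trace"

lemma h_closed: "h \<in> carrier (prime_field p)" and \<phi>_h: "\<phi> h = trace"
  using trace_in_P unfolding h_def P_def by (auto intro: inv_into_into f_inv_into_f)

lemma h_nonzero: "h \<noteq> \<zero>\<^bsub>prime_field p\<^esub>"
  using \<phi>_h trace_nonzero by auto

lemma \<phi>_shift: "\<phi> ((int i mod int p) \<otimes>\<^bsub>prime_field p\<^esub> h) = shift i"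
  using h_closed Z.mod_in_carrier[of "int i"]
  by (simp add: \<phi>_of_nat \<phi>_h shift_def add_pow_ldistr)

text \<open>Cancelling the nonzero h in Z_p gives injectivity, and equal cardinality gives
  surjectivity. Sums over \<open>P\<close> thereby become sums over exponents i.\<close>

lemma bij_shift: "bij_betw shift {..<p} P"
proof -
  have "inj_on shift {..<p}"
  proof (rule inj_onI)
    fix i j assume ij: "i \<in> {..<p}" "j \<in> {..<p}" and eq: "shift i = shift j"
    have c: "int k mod int p \<in> carrier (prime_field p)" for k by simp
    have "(int i mod int p) \<otimes>\<^bsub>prime_field p\<^esub> h = (int j mod int p) \<otimes>\<^bsub>prime_field p\<^esub> h"
      using eq unfolding \<phi>_shift[symmetric]
      by (rule inj_onD[OF inj_\<phi>]) (use c h_closed in auto)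
    hence "int i mod int p = int j mod int p"
      using Z.m_rcancel[OF h_nonzero h_closed c c] by simp
    thus "i = j" using ij by simp
  qed
  moreover from this have "shift ` {..<p} = P"
    using shift_in_P card_P by (intro card_subset_eq[OF finite_P]) (auto simp: card_image)
  ultimately show ?thesis unfolding bij_betw_def by simp
qed

lemma shift_nonzero: "i \<in> {1..p - 1} \<Longrightarrow> shift i \<noteq> \<zero>"
proof
  assume i: "i \<in> {1..p - 1}" and z: "shift i = \<zero>"
  have "shift i = shift 0" using z by (simp add: shift_def)
  hence "i = 0"
    by (rule inj_onD[OF bij_betw_imp_inj_on[OF bij_shift]]) (use i prime_gt_0_nat[OF p_prime] in auto)
  thus False using i by simp
qed

definition \<gamma> :: 'c where "\<gamma> = inv\<^bsub>L\<^esub> \<beta>"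

text \<open>The explicit inverse suits the partial fractions; \<open>\<gamma>_pow_conjugate\<close>
  identifies it with the power of \<gamma>.\<close>

definition conjugate :: "nat \<Rightarrow> 'c" where "conjugate i = inv\<^bsub>L\<^esub> (\<beta> \<oplus>\<^bsub>L\<^esub> \<iota> (shift i))"

lemma conjugate_closed [simp]: "conjugate i \<in> carrier L"
  and conjugate_mult: "conjugate i \<otimes>\<^bsub>L\<^esub> (\<beta> \<oplus>\<^bsub>L\<^esub> \<iota> (shift i)) = \<one>\<^bsub>L\<^esub>"
  unfolding conjugate_def using inv_closed[OF shift_in_P] inv_mult[OF shift_in_P] by auto

lemma conjugate_zero: "conjugate 0 = \<gamma>"
  unfolding conjugate_def shift_def \<gamma>_def by simp

lemma \<gamma>_closed [simp]: "\<gamma> \<in> carrier L"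
  using conjugate_closed[of 0] unfolding conjugate_zero .

lemma \<gamma>_mult: "\<gamma> \<otimes>\<^bsub>L\<^esub> \<beta> = \<one>\<^bsub>L\<^esub>"
  using conjugate_mult[of 0] unfolding conjugate_zero by (simp add: shift_def)

lemma \<beta>_pow_conjugate: "\<beta> [^]\<^bsub>L\<^esub> (p ^ (i * n)) = \<beta> \<oplus>\<^bsub>L\<^esub> \<iota> (shift i)"
proof (induction i)
  case 0
  show ?case by (simp add: shift_def)
next
  case (Suc i)
  have "\<beta> [^]\<^bsub>L\<^esub> (p ^ (Suc i * n)) = (\<beta> [^]\<^bsub>L\<^esub> (p ^ (i * n))) [^]\<^bsub>L\<^esub> (p ^ n)"
    by (simp add: L.nat_pow_pow power_add mult.commute)
  also have "\<dots> = \<beta> \<oplus>\<^bsub>L\<^esub> \<iota> trace \<oplus>\<^bsub>L\<^esub> \<iota> (shift i)"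
    unfolding Suc.IH by (simp add: L_pow_power_add \<beta>_pow_q \<iota>.hom_nat_pow[symmetric] F_pow)
  also have "\<dots> = \<beta> \<oplus>\<^bsub>L\<^esub> \<iota> (shift (Suc i))"
    using shift_closed[of i] by (simp add: shift_def L.a_ac)
  finally show ?case .
qed

lemma \<gamma>_pow_conjugate: "\<gamma> [^]\<^bsub>L\<^esub> (p ^ (i * n)) = conjugate i"
proof -
  have "(\<beta> \<oplus>\<^bsub>L\<^esub> \<iota> (shift i)) \<otimes>\<^bsub>L\<^esub> \<gamma> [^]\<^bsub>L\<^esub> (p ^ (i * n)) = (\<beta> \<otimes>\<^bsub>L\<^esub> \<gamma>) [^]\<^bsub>L\<^esub> (p ^ (i * n))"
    unfolding \<beta>_pow_conjugate[symmetric] by (simp add: L.nat_pow_distrib)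
  also have "\<dots> = \<one>\<^bsub>L\<^esub>"
    using \<gamma>_mult by (simp add: L.m_comm)
  finally show ?thesis
    unfolding conjugate_def by (intro L.comm_inv_char[symmetric]) auto
qed

lemma conjugate_independent: "L.independent (\<iota> ` carrier F) (map conjugate [0..<p])"
proof (rule L.trivial_combine_imp_independent[OF subfield_\<iota>])
  show "set (map conjugate [0..<p]) \<subseteq> carrier L" by auto
next
  fix Ks assume Ks: "set Ks \<subseteq> \<iota> ` carrier F" and zero: "L.combine Ks (map conjugate [0..<p]) = \<zero>\<^bsub>L\<^esub>"
  \<comment> \<open>\<open>combine\<close> accepts coefficient lists of any length and ignores the
    excess, so \<open>Ks\<close> is cut or padded with zeros to length exactly p.\<close>
  define Ks' where "Ks' = take p Ks @ replicate (p - length Ks) \<zero>\<^bsub>L\<^esub>"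
  have len: "length Ks' = p" unfolding Ks'_def by auto
  have "\<zero>\<^bsub>L\<^esub> \<in> \<iota> ` carrier F"
    using \<iota>.hom_zero by (metis imageI zero_closed)
  hence Ks': "set Ks' \<subseteq> \<iota> ` carrier F"
    unfolding Ks'_def using Ks set_take_subset[of p Ks] by auto
  hence Ks'L: "set Ks' \<subseteq> carrier L" using subfieldE(3)[OF subfield_\<iota>] by auto
  have "L.combine Ks' (map conjugate [0..<p]) = L.combine (take (length (map conjugate [0..<p])) Ks) (map conjugate [0..<p])"
    unfolding Ks'_def by (subst L.combine_append_replicate) auto
  also have "\<dots> = \<zero>\<^bsub>L\<^esub>"
    unfolding L.combine_take zero ..
  finally have sum: "(\<Oplus>\<^bsub>L\<^esub>i\<in>{..<p}. Ks' ! i \<otimes>\<^bsub>L\<^esub> conjugate i) = \<zero>\<^bsub>L\<^esub>"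
    using L.combine_map_upt[of conjugate Ks' p] Ks'L len by simp
  \<comment> \<open>The coefficients are pulled back to \<open>F\<close> along
    \<open>\<iota>\<close> and reindexed by \<open>P\<close> along \<open>shift\<close>, the form
    \<open>inv_independent\<close> expects.\<close>
  define a where "a j = inv_into (carrier F) \<iota> (Ks' ! inv_into {..<p} shift j)" for j
  have Ks'_nth: "Ks' ! i \<in> \<iota> ` carrier F" if "i < p" for i
    using that Ks' len by (meson nth_mem subsetD)
  have a_shift: "a (shift i) \<in> carrier F \<and> \<iota> (a (shift i)) = Ks' ! i" if "i < p" for i
  proof -
    have "inv_into {..<p} shift (shift i) = i"
      using that by (intro inv_into_f_f bij_betw_imp_inj_on[OF bij_shift]) auto
    thus ?thesis unfolding a_def using Ks'_nth[OF that]
      by (auto intro: inv_into_into f_inv_into_f)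
  qed
  have P_eq: "P = shift ` {..<p}" using bij_shift unfolding bij_betw_def by simp
  have a: "a \<in> P \<rightarrow> carrier F" unfolding P_eq using a_shift by auto
  have "(\<Oplus>\<^bsub>L\<^esub>j\<in>P. \<iota> (a j) \<otimes>\<^bsub>L\<^esub> inv\<^bsub>L\<^esub> (\<beta> \<oplus>\<^bsub>L\<^esub> \<iota> j)) = (\<Oplus>\<^bsub>L\<^esub>i\<in>{..<p}. \<iota> (a (shift i)) \<otimes>\<^bsub>L\<^esub> conjugate i)"
    unfolding P_eq conjugate_def
  proof (rule L.add.finprod_reindex)
    show "(\<lambda>j. \<iota> (a j) \<otimes>\<^bsub>L\<^esub> inv\<^bsub>L\<^esub> (\<beta> \<oplus>\<^bsub>L\<^esub> \<iota> j)) \<in> shift ` {..<p} \<rightarrow> carrier L"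
      unfolding P_eq[symmetric] using a inv_closed by (auto simp: Pi_iff)
  qed (rule bij_betw_imp_inj_on[OF bij_shift])
  also have "\<dots> = (\<Oplus>\<^bsub>L\<^esub>i\<in>{..<p}. Ks' ! i \<otimes>\<^bsub>L\<^esub> conjugate i)"
    using a_shift Ks'L len by (intro L.finsum_cong') (auto simp: subset_iff)
  finally have "a j = \<zero>" if "j \<in> P" for j
    using inv_independent[OF a _ that] sum by simp
  hence "Ks' ! i = \<zero>\<^bsub>L\<^esub>" if "i < p" for i
    using a_shift[OF that] shift_in_P[of i] \<iota>.hom_zero by simp
  hence "set Ks' \<subseteq> {\<zero>\<^bsub>L\<^esub>}"
    using len by (auto simp: in_set_conv_nth)
  thus "set (take (length (map conjugate [0..<p])) Ks) \<subseteq> {\<zero>\<^bsub>L\<^esub>}"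
    unfolding Ks'_def by simp
qed

lemma conjugate_basis: "is_basis L (\<iota> ` carrier F) (map conjugate [0..<p])"
proof -
  have "set (map conjugate [0..<p]) \<subseteq> carrier L" by auto
  \<comment> \<open>In dimension p, an independent list of length p spans.\<close>
  hence "L.Span (\<iota> ` carrier F) (map conjugate [0..<p]) = carrier L"
    using L.independent_length_eq_dimension[OF subfield_\<iota> L_dim conjugate_independent]
    by (simp del: L.Span.simps)
  thus ?thesis unfolding is_basis_def using conjugate_independent by (simp del: L.Span.simps)
qed

lemma sum_conjugate: "(\<Oplus>\<^bsub>L\<^esub>i\<in>{0..p - 1}. conjugate i) = \<iota> (\<ominus> (inv \<alpha>))"
proof -
  have set: "{0..p - 1} = {..<p}" using prime_gt_0_nat[OF p_prime] by auto
  have P_eq: "shift ` {..<p} = P" using bij_shift unfolding bij_betw_def by simp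
  have "(\<Oplus>\<^bsub>L\<^esub>i\<in>{..<p}. conjugate i) = (\<Oplus>\<^bsub>L\<^esub>j\<in>P. inv\<^bsub>L\<^esub> (\<beta> \<oplus>\<^bsub>L\<^esub> \<iota> j))"
    unfolding P_eq[symmetric] conjugate_def
  proof (rule L.add.finprod_reindex[symmetric])
    show "(\<lambda>j. inv\<^bsub>L\<^esub> (\<beta> \<oplus>\<^bsub>L\<^esub> \<iota> j)) \<in> shift ` {..<p} \<rightarrow> carrier L"
      unfolding P_eq using inv_closed by auto
  qed (rule bij_betw_imp_inj_on[OF bij_shift])
  thus ?thesis unfolding set using sum_inv by simp
qed

section \<open>Product formulas with the scalars (ih)^(-1)\<close>

definition c :: "nat \<Rightarrow> 'c" where
  "c i = \<iota> (\<phi> (inv\<^bsub>prime_field p\<^esub> ((int i mod int p) \<otimes>\<^bsub>prime_field p\<^esub> h)))"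

lemma c_closed_mult:
  assumes i: "i \<in> {1..p - 1}"
  shows "c i \<in> carrier L" "c i \<otimes>\<^bsub>L\<^esub> \<iota> (shift i) = \<one>\<^bsub>L\<^esub>"
proof -
  let ?z = "(int i mod int p) \<otimes>\<^bsub>prime_field p\<^esub> h"
  have z: "?z \<in> carrier (prime_field p)" using h_closed by simp
  have "?z \<noteq> \<zero>\<^bsub>prime_field p\<^esub>" using \<phi>_shift[of i] shift_nonzero[OF i] by auto
  hence u: "?z \<in> Units (prime_field p)" using z by (auto simp: Z.field_Units)
  show "c i \<in> carrier L" unfolding c_def using u by simp
  have "\<phi> (inv\<^bsub>prime_field p\<^esub> ?z) \<otimes> \<phi> ?z = \<one>"
    using u z \<phi>.hom_mult[of "inv\<^bsub>prime_field p\<^esub> ?z" ?z] by simp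
  hence "\<iota> (\<phi> (inv\<^bsub>prime_field p\<^esub> ?z) \<otimes> shift i) = \<one>\<^bsub>L\<^esub>"
    unfolding \<phi>_shift by simp
  thus "c i \<otimes>\<^bsub>L\<^esub> \<iota> (shift i) = \<one>\<^bsub>L\<^esub>"
    unfolding c_def using u by simp
qed

text \<open>With e = ih, this is the decomposition of 1 / (\<beta> (\<beta> + e)) into e^(-1) times
  the difference of 1 / \<beta> and 1 / (\<beta> + e).\<close>

lemma conjugate_times_\<gamma>:
  assumes i: "i \<in> {1..p - 1}"
  shows "conjugate i \<otimes>\<^bsub>L\<^esub> \<gamma> = c i \<otimes>\<^bsub>L\<^esub> \<gamma> \<ominus>\<^bsub>L\<^esub> c i \<otimes>\<^bsub>L\<^esub> conjugate i"
proof -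
  note ci = c_closed_mult[OF i]
  define e where "e = \<iota> (shift i)"
  have e: "e \<in> carrier L" unfolding e_def by simp
  \<comment> \<open>Each summand is expanded by the other denominator times its inverse; the terms
    with \<beta> then cancel and only e is left.\<close>
  have "c i \<otimes>\<^bsub>L\<^esub> \<gamma> \<ominus>\<^bsub>L\<^esub> c i \<otimes>\<^bsub>L\<^esub> conjugate i
      = c i \<otimes>\<^bsub>L\<^esub> \<gamma> \<otimes>\<^bsub>L\<^esub> (conjugate i \<otimes>\<^bsub>L\<^esub> (\<beta> \<oplus>\<^bsub>L\<^esub> e)) \<ominus>\<^bsub>L\<^esub> c i \<otimes>\<^bsub>L\<^esub> conjugate i \<otimes>\<^bsub>L\<^esub> (\<gamma> \<otimes>\<^bsub>L\<^esub> \<beta>)"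
    unfolding e_def conjugate_mult \<gamma>_mult using ci(1) by simp
  also have "\<dots> = (c i \<otimes>\<^bsub>L\<^esub> e) \<otimes>\<^bsub>L\<^esub> (conjugate i \<otimes>\<^bsub>L\<^esub> \<gamma>)"
    using ci(1) e conjugate_closed[of i] \<gamma>_closed \<beta>_closed by algebra
  also have "\<dots> = conjugate i \<otimes>\<^bsub>L\<^esub> \<gamma>"
    unfolding e_def ci(2) by simp
  finally show ?thesis ..
qed

text \<open>The sum of all conjugates times \<gamma> is \<gamma>^2 plus the mixed products, and
  summing \<open>conjugate_times_\<gamma>\<close> over i evaluates the latter.\<close>

lemma \<gamma>_square:
  "\<gamma> [^]\<^bsub>L\<^esub> (2::nat) = ((\<Oplus>\<^bsub>L\<^esub>i\<in>{0..p - 1}. conjugate i) \<ominus>\<^bsub>L\<^esub> (\<Oplus>\<^bsub>L\<^esub>i\<in>{1..p - 1}. c i)) \<otimes>\<^bsub>L\<^esub> \<gamma>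
     \<oplus>\<^bsub>L\<^esub> (\<Oplus>\<^bsub>L\<^esub>i\<in>{1..p - 1}. c i \<otimes>\<^bsub>L\<^esub> conjugate i)"
proof -
  let ?I = "{1..p - 1}"
  define T where "T = (\<Oplus>\<^bsub>L\<^esub>i\<in>?I. conjugate i)"
  define C where "C = (\<Oplus>\<^bsub>L\<^esub>i\<in>?I. c i)"
  define D where "D = (\<Oplus>\<^bsub>L\<^esub>i\<in>?I. c i \<otimes>\<^bsub>L\<^esub> conjugate i)"
  have cl: "T \<in> carrier L" "C \<in> carrier L" "D \<in> carrier L"
    unfolding T_def C_def D_def using c_closed_mult(1) by (auto intro!: L.finsum_closed)
  have "T \<otimes>\<^bsub>L\<^esub> \<gamma> = (\<Oplus>\<^bsub>L\<^esub>i\<in>?I. conjugate i \<otimes>\<^bsub>L\<^esub> \<gamma>)"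
    unfolding T_def by (intro L.finsum_ldistr) auto
  hence "T \<otimes>\<^bsub>L\<^esub> \<gamma> \<oplus>\<^bsub>L\<^esub> D = (\<Oplus>\<^bsub>L\<^esub>i\<in>?I. conjugate i \<otimes>\<^bsub>L\<^esub> \<gamma> \<oplus>\<^bsub>L\<^esub> c i \<otimes>\<^bsub>L\<^esub> conjugate i)"
    unfolding D_def using c_closed_mult(1) by (simp add: L.finsum_addf Pi_iff)
  also have "\<dots> = (\<Oplus>\<^bsub>L\<^esub>i\<in>?I. c i \<otimes>\<^bsub>L\<^esub> \<gamma>)"
  proof (rule L.finsum_cong', rule refl)
    fix i assume i: "i \<in> ?I"
    show "conjugate i \<otimes>\<^bsub>L\<^esub> \<gamma> \<oplus>\<^bsub>L\<^esub> c i \<otimes>\<^bsub>L\<^esub> conjugate i = c i \<otimes>\<^bsub>L\<^esub> \<gamma>"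
      unfolding conjugate_times_\<gamma>[OF i] using c_closed_mult(1)[OF i] conjugate_closed[of i] \<gamma>_closed by algebra
  qed (use c_closed_mult(1) in auto)
  also have "\<dots> = C \<otimes>\<^bsub>L\<^esub> \<gamma>"
    unfolding C_def using c_closed_mult(1) by (intro L.finsum_ldistr[symmetric]) auto
  finally have key: "T \<otimes>\<^bsub>L\<^esub> \<gamma> \<oplus>\<^bsub>L\<^esub> D = C \<otimes>\<^bsub>L\<^esub> \<gamma>" .
  \<comment> \<open>The index 0 contributes \<gamma> itself, the source of the square.\<close>
  have "{0..p - 1} = insert 0 ?I" by auto
  hence S: "(\<Oplus>\<^bsub>L\<^esub>i\<in>{0..p - 1}. conjugate i) = \<gamma> \<oplus>\<^bsub>L\<^esub> T"
    unfolding T_def by (simp add: conjugate_zero)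
  have "(\<gamma> \<oplus>\<^bsub>L\<^esub> T \<ominus>\<^bsub>L\<^esub> C) \<otimes>\<^bsub>L\<^esub> \<gamma> \<oplus>\<^bsub>L\<^esub> D
      = \<gamma> \<otimes>\<^bsub>L\<^esub> \<gamma> \<oplus>\<^bsub>L\<^esub> (T \<otimes>\<^bsub>L\<^esub> \<gamma> \<oplus>\<^bsub>L\<^esub> D \<ominus>\<^bsub>L\<^esub> C \<otimes>\<^bsub>L\<^esub> \<gamma>)"
    using cl \<gamma>_closed by algebra
  also have "\<dots> = \<gamma> [^]\<^bsub>L\<^esub> (2::nat)"
    unfolding key using cl by (simp add: numeral_2_eq_2)
  finally show ?thesis unfolding S C_def[symmetric] D_def[symmetric] ..
qed

end

section \<open>The rupture field\<close>

lemma (in field) artin_schreier_poly_closed: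
  assumes "\<alpha> \<in> carrier R"
  shows "artin_schreier_poly R p \<alpha> \<in> carrier (poly_ring R)"
proof -
  interpret UP: domain "poly_ring R"
    using univ_poly_is_domain[OF carrier_is_subring] .
  have "X \<in> carrier (poly_ring R)" "poly_of_const \<alpha> \<in> carrier (poly_ring R)"
    using var_closed(1)[OF carrier_is_subring] assms
      canonical_embedding_is_hom[OF carrier_is_subring] by (auto dest: ring_hom_memE(1))
  thus ?thesis unfolding artin_schreier_poly_def by simp
qed

text \<open>Since \<open>p \<ge> 2\<close>, the leading power strictly dominates both the linear
  term and the constant.\<close>

lemma (in field) degree_artin_schreier_poly:
  assumes \<alpha>: "\<alpha> \<in> carrier R" and p: "p \<ge> 2"
  shows "degree (artin_schreier_poly R p \<alpha>) = p"
proof -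
  interpret UP: domain "poly_ring R"
    using univ_poly_is_domain[OF carrier_is_subring] .
  have X: "X \<in> carrier (poly_ring R)" and c: "poly_of_const \<alpha> \<in> carrier (poly_ring R)"
    using var_closed(1)[OF carrier_is_subring] \<alpha>
      canonical_embedding_is_hom[OF carrier_is_subring] by (auto dest: ring_hom_memE(1))
  have deg_add: "degree (f \<oplus>\<^bsub>poly_ring R\<^esub> g) = degree f"
    if "f \<in> carrier (poly_ring R)" "g \<in> carrier (poly_ring R)" "degree g < degree f" for f g
    using poly_add_degree_eq[OF carrier_is_subring, of f g] that
    by (simp add: univ_poly_carrier univ_poly_add)
  have "degree X = 1" by (simp add: var_def)
  hence Xp: "degree (X [^]\<^bsub>poly_ring R\<^esub> p) = p"
    and mX: "degree (\<ominus>\<^bsub>poly_ring R\<^esub> X) = 1"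
    using polynomial_pow_degree[OF X] univ_poly_a_inv_degree[OF carrier_is_subring X] by simp_all
  have mc: "degree (\<ominus>\<^bsub>poly_ring R\<^esub> poly_of_const \<alpha>) = 0"
    using univ_poly_a_inv_degree[OF carrier_is_subring c] by (auto simp: poly_of_const_def)
  have "degree (X [^]\<^bsub>poly_ring R\<^esub> p \<oplus>\<^bsub>poly_ring R\<^esub> \<ominus>\<^bsub>poly_ring R\<^esub> X) = p"
    using X Xp mX p by (subst deg_add) auto
  thus ?thesis
    unfolding artin_schreier_poly_def a_minus_def using X c mc p by (subst deg_add) auto
qed

lemma (in domain) rupture_surj_self_zero:
  assumes f: "f \<in> carrier (poly_ring R)"
  shows "rupture_surj (carrier R) f f = \<zero>\<^bsub>Rupt (carrier R) f\<^esub>"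
proof -
  interpret UP: domain "poly_ring R"
    using univ_poly_is_domain[OF carrier_is_subring] .
  have "f \<in> PIdl\<^bsub>poly_ring R\<^esub> f"
    using UP.cgenideal_self[OF f] .
  thus ?thesis
    using UP.a_rcos_zero[OF UP.cgenideal_ideal[OF f]] unfolding rupture_def FactRing_def by simp
qed

text \<open>The quotient map is injective on remainders modulo \<open>f\<close>, and a polynomial of
  degree below that of \<open>f\<close> is its own remainder. This supplies
  \<open>\<sigma>_zeroD\<close>.\<close>

lemma (in field) rupture_surj_zeroD:
  assumes f: "f \<in> carrier (poly_ring R)" and g: "g \<in> carrier (poly_ring R)"
    and deg: "degree g < degree f" and zero: "rupture_surj (carrier R) f g = \<zero>\<^bsub>Rupt (carrier R) f\<^esub>"
  shows "g = []"
proof -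
  interpret UP: domain "poly_ring R"
    using univ_poly_is_domain[OF carrier_is_subring] .
  interpret \<sigma>: ring_hom_ring "poly_ring R" "Rupt (carrier R) f" "rupture_surj (carrier R) f"
    using rupture_surj_hom(2)[OF carrier_is_subring f] .
  have nil: "[] \<in> carrier (poly_ring R)" using UP.zero_closed by (simp add: univ_poly_zero)
  have "g pmod f = g" "[] pmod f = []"
    using pmod_const(2)[OF carrier_is_subfield g f] long_division_zero(2)[OF carrier_is_subfield f] deg
    by auto
  hence mem: "g \<in> (\<lambda>q. q pmod f) ` carrier (poly_ring R)" "[] \<in> (\<lambda>q. q pmod f) ` carrier (poly_ring R)"
    using g nil by (metis imageI)+
  have "rupture_surj (carrier R) f g = rupture_surj (carrier R) f []"
    using zero \<sigma>.hom_zero by (simp add: univ_poly_zero)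
  thus ?thesis
    using inj_onD[OF rupture_surj_inj_on[OF carrier_is_subfield f] _ mem] by simp
qed

text \<open>As Z_p enters through \<open>\<phi>\<close>, the element h is stated as a residue whose
  image is the trace sum; injectivity of \<open>\<phi>\<close> leaves only one such residue.\<close>

theorem mainTheorem5:
  fixes p n :: nat
    and F :: "('a, 'b) ring_scheme"
    and \<phi> :: "int \<Rightarrow> 'a"
    and \<alpha> :: 'a
    and L :: "'a list set ring"
    and \<iota> :: "'a \<Rightarrow> 'a list set"
    and \<beta> \<gamma> :: "'a list set"
    and c :: "int \<Rightarrow> nat \<Rightarrow> 'a list set"
  assumes p: "Factorial_Ring.prime p"
    and F: "field F"
    and \<phi>: "\<phi> \<in> ring_hom (prime_field p) F"
    and n: "n \<ge> 1" "ring.dimension F n (\<phi> ` carrier (prime_field p)) (carrier F)"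
    and \<alpha>: "\<alpha> \<in> carrier F" "\<alpha> \<noteq> \<zero>\<^bsub>F\<^esub>"
    and irr: "pirreducible\<^bsub>F\<^esub> (carrier F) (artin_schreier_poly F p \<alpha>)"
    and L_def: "L = artin_schreier_ext F p \<alpha>"
    and \<iota>_def: "\<iota> = artin_schreier_emb F p \<alpha>"
    and \<beta>_def: "\<beta> = artin_schreier_root F p \<alpha>"
    and \<gamma>_def: "\<gamma> = inv\<^bsub>L\<^esub> \<beta>"
    and c_def: "\<And>h i. c h i =
          \<iota> (\<phi> (inv\<^bsub>prime_field p\<^esub> ((int i mod int p) \<otimes>\<^bsub>prime_field p\<^esub> h)))"
  shows "is_basis L (\<iota> ` carrier F) (map (\<lambda>i. \<gamma> [^]\<^bsub>L\<^esub> (p ^ (i * n))) [0..<p]) \<and>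
         (\<exists>h. h \<in> carrier (prime_field p) \<and> h \<noteq> \<zero>\<^bsub>prime_field p\<^esub> \<and>
          \<phi> h = (\<Oplus>\<^bsub>F\<^esub>i\<in>{0..n - 1}. \<alpha> [^]\<^bsub>F\<^esub> (p ^ i)) \<and>
          (\<forall>i\<in>{1..p - 1}. \<gamma> [^]\<^bsub>L\<^esub> (p ^ (i * n) + 1) =
             c h i \<otimes>\<^bsub>L\<^esub> \<gamma> \<ominus>\<^bsub>L\<^esub> c h i \<otimes>\<^bsub>L\<^esub> \<gamma> [^]\<^bsub>L\<^esub> (p ^ (i * n))) \<and>
          \<gamma> [^]\<^bsub>L\<^esub> (2::nat) =
             ((\<Oplus>\<^bsub>L\<^esub>i\<in>{0..p - 1}. \<gamma> [^]\<^bsub>L\<^esub> (p ^ (i * n))) \<ominus>\<^bsub>L\<^esub> (\<Oplus>\<^bsub>L\<^esub>i\<in>{1..p - 1}. c h i)) \<otimes>\<^bsub>L\<^esub> \<gamma>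
             \<oplus>\<^bsub>L\<^esub> (\<Oplus>\<^bsub>L\<^esub>i\<in>{1..p - 1}. c h i \<otimes>\<^bsub>L\<^esub> \<gamma> [^]\<^bsub>L\<^esub> (p ^ (i * n)))) \<and>
         (\<Oplus>\<^bsub>L\<^esub>i\<in>{0..p - 1}. \<gamma> [^]\<^bsub>L\<^esub> (p ^ (i * n))) = \<iota> (\<ominus>\<^bsub>F\<^esub> (inv\<^bsub>F\<^esub> \<alpha>))"
proof -
  let ?f = "artin_schreier_poly F p \<alpha>"
  interpret F: field F by fact
  interpret E: prime_residue_hom F p \<phi>
    by unfold_locales (use p \<phi> in auto)
  have p2: "p \<ge> 2" using prime_ge_2_nat[OF p] .
  have f: "?f \<in> carrier (poly_ring F)" using F.artin_schreier_poly_closed[OF \<alpha>(1)] .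
  have deg: "degree ?f = p" using F.degree_artin_schreier_poly[OF \<alpha>(1) p2] .
  have L: "L = Rupt\<^bsub>F\<^esub> (carrier F) ?f" unfolding L_def artin_schreier_ext_def ..
  define \<sigma> where "\<sigma> = F.rupture_surj (carrier F) ?f"
  \<comment> \<open>Irreducibility enters here: it makes the quotient a field.\<close>
  interpret L: field L
    unfolding L using F.rupture_is_field_iff_pirreducible[OF F.carrier_is_subfield f] irr by simp
  interpret \<sigma>: ring_hom_ring "poly_ring F" L \<sigma>
    unfolding L \<sigma>_def using F.rupture_surj_hom(2)[OF F.carrier_is_subring f] .
  have \<iota>: "\<iota> = \<sigma> \<circ> E.const"
    unfolding \<iota>_def artin_schreier_emb_def \<sigma>_def by (simp add: fun_eq_iff)
  have "\<iota> \<in> ring_hom F L"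
    using F.rupture_surj_norm_is_hom[OF F.carrier_is_subring f]
    unfolding \<iota> L \<sigma>_def by (simp add: ring_hom_def)
  hence "ring_hom_ring F L \<iota>"
    using F.ring_axioms L.ring_axioms by (intro ring_hom_ringI2)
  interpret \<iota>: ring_hom_ring F L \<iota> by fact
  have \<beta>: "\<sigma> X\<^bsub>F\<^esub> = \<beta>" unfolding \<beta>_def artin_schreier_root_def \<sigma>_def ..
  have \<beta>L: "\<beta> \<in> carrier L" using \<sigma>.hom_closed[OF E.X_closed] \<beta> by simp
  \<comment> \<open>The defining polynomial dies in the quotient; expanding its image gives the
    equation for \<beta>.\<close>
  have "\<sigma> ?f = \<zero>\<^bsub>L\<^esub>"
    using F.rupture_surj_self_zero[OF f] unfolding L \<sigma>_def .
  hence "\<beta> [^]\<^bsub>L\<^esub> p \<ominus>\<^bsub>L\<^esub> \<beta> \<ominus>\<^bsub>L\<^esub> \<iota> \<alpha> = \<zero>\<^bsub>L\<^esub>"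
    unfolding artin_schreier_poly_def a_minus_def using \<alpha>
    by (simp add: \<sigma>.hom_nat_pow \<beta> \<iota>)
  moreover have "\<iota> \<alpha> \<in> carrier L" using \<alpha> by simp
  ultimately have \<beta>_pow: "\<beta> [^]\<^bsub>L\<^esub> p = \<beta> \<oplus>\<^bsub>L\<^esub> \<iota> \<alpha>"
    using \<beta>L L.nat_pow_closed[OF \<beta>L, of p]
    by (metis L.minus_closed L.r_right_minus_eq L.a_comm L.minus_eq L.a_assoc L.a_inv_closed L.l_neg L.r_zero)
  interpret A: artin_schreier_extension F p \<phi> L \<iota> \<sigma> n \<alpha> \<beta>
  proof unfold_locales
    show "F.dimension n E.P (carrier F)" unfolding E.P_def by fact
    show "L.dimension p (\<iota> ` carrier F) (carrier L)"
      using F.rupture_dimension[OF F.carrier_is_subfield f] deg p2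
      unfolding L \<iota> \<sigma>_def image_comp by simp
    show "g = []" if "g \<in> carrier (poly_ring F)" "degree g < p" "\<sigma> g = \<zero>\<^bsub>L\<^esub>" for g
      using F.rupture_surj_zeroD[OF f that(1)] that deg unfolding L \<sigma>_def by simp
  qed (use n \<alpha> \<beta> \<beta>_pow in \<open>auto simp: \<iota>\<close>)
  have \<gamma>: "\<gamma> = A.\<gamma>" unfolding \<gamma>_def A.\<gamma>_def ..
  have c: "c A.h i = A.c i" for i unfolding c_def A.c_def ..
  have pow: "\<gamma> [^]\<^bsub>L\<^esub> (p ^ (i * n)) = A.conjugate i" for i
    unfolding \<gamma> by (rule A.\<gamma>_pow_conjugate)
  have pow_Suc: "\<gamma> [^]\<^bsub>L\<^esub> (p ^ (i * n) + 1) = A.conjugate i \<otimes>\<^bsub>L\<^esub> \<gamma>" for i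
    using pow[of i] by simp
  \<comment> \<open>For n = 0 truncated subtraction would leave the index 0 on the left;
    \<open>n \<ge> 1\<close> excludes this.\<close>
  have set: "{0..n - 1} = {..<n}" using n(1) by auto
  show ?thesis
    unfolding pow pow_Suc
  proof (intro conjI exI[of _ A.h] ballI)
    show "\<phi> A.h = (\<Oplus>\<^bsub>F\<^esub>i\<in>{0..n - 1}. \<alpha> [^]\<^bsub>F\<^esub> (p ^ i))"
      unfolding A.\<phi>_h A.trace_def set ..
  qed (use A.conjugate_basis A.h_closed A.h_nonzero A.conjugate_times_\<gamma> A.\<gamma>_square A.sum_conjugate in \<open>simp_all add: c \<gamma>\<close>)
qed

end
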